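(* For all integers $n\ge d\ge1$, $\rho(n,d)\le n-d$. Furthermore, if $n>2d$, then $\rho(n,d)\le n-d-1$.
   Context: Strings are indexed from 1. An integer $p\ge1$ is a period of $s$ if $s[m]=s[m+p]$ for all $1\le m\le |s|-p$. A run of a string $w$ of length $n$ is a triple $(i,j,p)$ with $1\le i\le j\le n$ such that $p$ is the smallest period of $w[i..j]$, $j-i+1\ge 2p$, ($i=1$ or $w[i-1]\ne w[i+p-1]$), and ($j=n$ or $w[j+1]\ne w[j-p+1]$). $\rho(n,d)$ is the maximum number of runs in a string of length $n$ that contains exactly $d$ distinct symbols. *)

theory Defs
  imports Main
begin

text \<open>Strings are lists. Positions are counted from 1, hence the index shift below.\<close>

definition sym :: "'a list \<Rightarrow> nat \<Rightarrow> 'a" where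
  "sym s m = s ! (m - 1)"

definition substring :: "'a list \<Rightarrow> nat \<Rightarrow> nat \<Rightarrow> 'a list" where
  "substring w i j = take (j + 1 - i) (drop (i - 1) w)"

definition is_period :: "'a list \<Rightarrow> nat \<Rightarrow> bool" where
  "is_period s p \<longleftrightarrow> 1 \<le> p \<and> (\<forall>m. 1 \<le> m \<and> m \<le> length s - p \<longrightarrow> sym s m = sym s (m + p))"

definition is_smallest_period :: "'a list \<Rightarrow> nat \<Rightarrow> bool" where
  "is_smallest_period s p \<longleftrightarrow> is_period s p \<and> (\<forall>q. is_period s q \<longrightarrow> p \<le> q)"

definition runs :: "'a list \<Rightarrow> (nat \<times> nat \<times> nat) set" where
  "runs w = {(i, j, p). 1 \<le> i \<and> i \<le> j \<and> j \<le> length w \<and>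
     is_smallest_period (substring w i j) p \<and>
     2 * p \<le> j - i + 1 \<and>
     (i = 1 \<or> sym w (i - 1) \<noteq> sym w (i + p - 1)) \<and>
     (j = length w \<or> sym w (j + 1) \<noteq> sym w (j - p + 1))}"

text \<open>A string with finitely many symbols can be renamed injectively into the natural
  numbers without changing its runs, so natural numbers serve as the unbounded alphabet.
  The lemmas below show that the maximum ranges over a finite set, which is
  nonempty for n \<ge> d \<ge> 1.\<close>

definition run_counts :: "nat \<Rightarrow> nat \<Rightarrow> nat set" where
  "run_counts n d = {card (runs w) | w :: nat list. length w = n \<and> card (set w) = d}"

definition \<rho> :: "nat \<Rightarrow> nat \<Rightarrow> nat" where
  "\<rho> n d = Max (run_counts n d)"

lemma runs_subset: "runs w \<subseteq> {..length w} \<times> {..length w} \<times> {..length w}"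
  by (auto simp: runs_def)

lemma finite_runs: "finite (runs w)"
  by (rule finite_subset[OF runs_subset]) simp

lemma finite_run_counts: "finite (run_counts n d)"
proof (rule finite_subset)
  show "run_counts n d \<subseteq> {..card ({..n} \<times> {..n} \<times> {..n})}"
    unfolding run_counts_def using card_mono[OF _ runs_subset] by fastforce
qed simp

lemma run_counts_nonempty:
  assumes "1 \<le> d" "d \<le> n"
  shows "run_counts n d \<noteq> {}"
proof -
  let ?w = "[0..<d] @ replicate (n - d) 0"
  have "set ?w = {0..<d}"
    using assms by auto
  then have "length ?w = n \<and> card (set ?w) = d"
    using assms by simp
  then show ?thesis
    unfolding run_counts_def by blast
qed

end

theory Submission
  imports Defs
begin

text \<open>As in the proof of the runs theorem, orient every run \<open>(i, j, p)\<close> by whether the symbol that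
  ends it is smaller or larger than the one \<open>p\<close> positions before, and assign to it the starting
  positions, other than \<open>i\<close> itself, of its Lyndon roots for this orientation. These sets are
  nonempty and pairwise disjoint, whatever the order of the symbols is.

  Order the symbols by their last occurrence, with an end marker above all of them. Then the
  start of the last block of each symbol, where a block is a maximal repetition of one symbol,
  lies in no such set, which leaves \<open>n - d\<close> positions. If \<open>n > 2 * d\<close>, then the string is not
  a concatenation of last blocks of length at most two. At the leftmost violation there is either
  a block start that no run reaches from the left, hence another unassigned position, or a run
  of period 1 with two positions in its set.\<close>

section \<open>Lexicographic comparison of sequences\<close>

definition lex_less :: "('a \<Rightarrow> 'a \<Rightarrow> bool) \<Rightarrow> (nat \<Rightarrow> 'a) \<Rightarrow> (nat \<Rightarrow> 'a) \<Rightarrow> bool" where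
  "lex_less R f g \<longleftrightarrow> (\<exists>h. (\<forall>x<h. f x = g x) \<and> R (f h) (g h))"

definition shift :: "nat \<Rightarrow> (nat \<Rightarrow> 'a) \<Rightarrow> nat \<Rightarrow> 'a" where
  "shift a v = (\<lambda>x. v (a + x))"

lemma lex_less_trans:
  assumes "transp R" "lex_less R f g" "lex_less R g k"
  shows "lex_less R f k"
proof -
  obtain x where x: "\<forall>z<x. f z = g z" "R (f x) (g x)"
    using assms(2) unfolding lex_less_def by blast
  obtain y where y: "\<forall>z<y. g z = k z" "R (g y) (k y)"
    using assms(3) unfolding lex_less_def by blast
  have "R (f (min x y)) (k (min x y))"
    using x y assms(1) by (cases x y rule: linorder_cases) (auto dest: transpD)
  moreover have "\<forall>z<min x y. f z = k z"
    using x y by auto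
  ultimately show ?thesis
    unfolding lex_less_def by blast
qed

lemma lex_less_irrefl:
  assumes "asymp R"
  shows "\<not> lex_less R f f"
  using assms unfolding lex_less_def by (meson asympD)

lemma lex_less_asym:
  assumes "transp R" "asymp R" "lex_less R f g"
  shows "\<not> lex_less R g f"
  using assms lex_less_trans lex_less_irrefl by metis

lemma lex_less_total:
  assumes "totalp R" "f \<noteq> g"
  shows "lex_less R f g \<or> lex_less R g f"
proof -
  define h where "h = (LEAST x. f x \<noteq> g x)"
  have "\<exists>x. f x \<noteq> g x"
    using assms(2) by blast
  then have "f h \<noteq> g h"
    unfolding h_def by (rule LeastI_ex)
  moreover have "\<forall>x<h. f x = g x"
    unfolding h_def using not_less_Least by blast
  ultimately show ?thesis
    using totalpD[OF assms(1), of "f h" "g h"] unfolding lex_less_def by metis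
qed

lemma lex_less_converse: "lex_less (>) f g \<longleftrightarrow> lex_less (<) g (f :: nat \<Rightarrow> nat)"
  unfolding lex_less_def by metis

lemma lex_less_shift_prefix:
  assumes "lex_less R f g" "\<And>x. x < t \<Longrightarrow> f x = g x" "asymp R"
  shows "lex_less R (shift t f) (shift t g)"
proof -
  obtain h where h: "\<forall>x<h. f x = g x" "R (f h) (g h)"
    using assms(1) unfolding lex_less_def by blast
  have "t \<le> h"
    using h(2) assms(2)[of h] asympD[OF assms(3)] by (metis not_le)
  then show ?thesis
    unfolding lex_less_def shift_def using h by (intro exI[of _ "h - t"]) auto
qed

text \<open>A minimal rotation of a primitive word has no border, so it is already distinguished
  from its proper suffixes inside the word.\<close>

lemma ex_minimal_rotation:
  fixes u :: "nat \<Rightarrow> 'a"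
  assumes R: "transp R" "asymp R" "totalp R"
    and p: "0 < p" and per: "\<And>x. u (x + p) = u x"
    and prim: "\<And>a q. 0 < q \<Longrightarrow> q < p \<Longrightarrow> shift a u \<noteq> shift (a + q) u"
  shows "\<exists>a. c \<le> a \<and> a < c + p \<and> (\<forall>b. a < b \<and> b < a + p \<longrightarrow>
    (\<exists>h. b + h < a + p \<and> (\<forall>x<h. u (a + x) = u (b + x)) \<and> R (u (a + h)) (u (b + h))))"
proof -
  let ?less = "\<lambda>a b. lex_less R (shift a u) (shift b u)"
  have shp: "shift (a + p) u = shift a u" for a
    using per[of "a + _"] by (auto simp: shift_def ac_simps)
  obtain a where a: "a \<in> {c..<c + p}" "\<forall>b\<in>{c..<c + p}. b \<noteq> a \<longrightarrow> \<not> ?less b a"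
  proof -
    have "asymp_on {c..<c + p} ?less"
      using R by (auto intro!: asymp_onI dest: lex_less_asym)
    moreover have "transp_on {c..<c + p} ?less"
      using R by (auto intro!: transp_onI intro: lex_less_trans)
    ultimately show ?thesis
      using that Finite_Set.bex_min_element[of "{c..<c + p}" ?less] p by auto
  qed
  \<comment> \<open>Periodicity carries minimality from the window at \<open>c\<close> to the window
    at \<open>a\<close>: a start \<open>b\<close> beyond the first window has the same shift as
    \<open>b - p\<close>.\<close>
  have min: "\<not> ?less b a" if b: "a \<le> b" "b < a + p" for b
  proof (cases "b < c + p")
    case True
    then show ?thesis
      using a b lex_less_irrefl[OF R(2)] by (cases "a = b") auto
  next
    case False
    then have "b - p \<in> {c..<c + p}" "b - p \<noteq> a"
      using a(1) b by auto
    then have "\<not> ?less (b - p) a"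
      using a(2) by blast
    then show ?thesis
      using shp[of "b - p"] False by simp
  qed
  have "\<exists>h. b + h < a + p \<and> (\<forall>x<h. u (a + x) = u (b + x)) \<and> R (u (a + h)) (u (b + h))"
    if b: "a < b" "b < a + p" for b
  proof -
    have ab: "?less a b"
      using lex_less_total[OF R(3), of "shift a u" "shift b u"] min[of b] b prim[of "b - a" a] by auto
    then obtain h where h: "\<forall>x<h. u (a + x) = u (b + x)" "R (u (a + h)) (u (b + h))"
      unfolding lex_less_def shift_def by blast
    have "b + h < a + p"
    proof (rule ccontr)
      assume "\<not> b + h < a + p"
      \<comment> \<open>If the first difference came only at \<open>a + p\<close> or later, the
        factor of length \<open>t\<close> from \<open>b\<close> to \<open>a + p\<close> would be a
        border. Stripping it leaves the shift at \<open>a + t\<close> below the shift at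
        \<open>a + p\<close>, which is the one at \<open>a\<close>, against minimality.\<close>
      define t where "t = a + p - b"
      have "?less (a + t) (b + t)"
        using lex_less_shift_prefix[OF ab, of t] h \<open>\<not> b + h < a + p\<close> R
        by (auto simp: t_def shift_def ac_simps)
      moreover have "b + t = a + p"
        using b by (simp add: t_def)
      moreover have "a \<le> a + t" "a + t < a + p"
        using b by (simp_all add: t_def)
      ultimately show False
        using shp[of a] min[of "a + t"] by simp
    qed
    then show ?thesis
      using h by blast
  qed
  then show ?thesis
    using a by auto
qed

section \<open>Lyndon roots of runs\<close>

text \<open>Positions \<open>1..n\<close> of a string, padded by a symbol below all others on the left and
  by one above all others on the right; every symbol is coded by its last position.\<close>

locale last_position_coding =
  fixes n :: nat and v :: "nat \<Rightarrow> nat"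
  assumes v_zero: "v 0 = 0"
    and v_beyond: "n < m \<Longrightarrow> v m = Suc n"
    and v_bounds: "1 \<le> m \<Longrightarrow> m \<le> n \<Longrightarrow> m \<le> v m \<and> v m \<le> n"
    and v_last: "1 \<le> m \<Longrightarrow> m \<le> n \<Longrightarrow> v (v m) = v m"
begin

text \<open>Maximality has no special cases at the ends of the string, because the padding symbols
  \<open>0\<close> and \<open>Suc n\<close> differ from every symbol inside.\<close>

definition is_run :: "nat \<Rightarrow> nat \<Rightarrow> nat \<Rightarrow> bool" where
  "is_run i j p \<longleftrightarrow> 1 \<le> i \<and> 1 \<le> p \<and> i + 2 * p \<le> Suc j \<and> j \<le> n \<and>
    (\<forall>m. i \<le> m \<and> m + p \<le> j \<longrightarrow> v m = v (m + p)) \<and>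
    (\<forall>q. 0 < q \<and> q < p \<longrightarrow> (\<exists>m. i \<le> m \<and> m + q \<le> j \<and> v m \<noteq> v (m + q))) \<and>
    v (i - 1) \<noteq> v (i + p - 1) \<and> v (Suc j) \<noteq> v (Suc j - p)"

abbreviation suffix_less :: "(nat \<Rightarrow> nat \<Rightarrow> bool) \<Rightarrow> nat \<Rightarrow> nat \<Rightarrow> bool" where
  "suffix_less R a b \<equiv> lex_less R (shift a v) (shift b v)"

definition orientation :: "nat \<Rightarrow> nat \<Rightarrow> nat \<Rightarrow> nat \<Rightarrow> bool" where
  "orientation j p = (if v (Suc j) < v (Suc j - p) then (<) else (>))"

text \<open>Comparing whole suffixes instead of the factors of length \<open>p\<close> makes \<open>p\<close> the distance to the
  next smaller suffix, so that equal starts and equal orientations force equal periods.\<close>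

definition lyndon_starts :: "nat \<Rightarrow> nat \<Rightarrow> nat \<Rightarrow> nat set" where
  "lyndon_starts i j p = {a. i < a \<and> a + p \<le> Suc j \<and>
    (\<forall>b. a < b \<and> b < a + p \<longrightarrow> suffix_less (orientation j p) a b)}"

lemma orientation_order:
  "transp (orientation j p)" "asymp (orientation j p)" "totalp (orientation j p)"
  by (auto simp: orientation_def)

lemma is_runD:
  assumes "is_run i j p"
  shows "1 \<le> i" "1 \<le> p" "i + 2 * p \<le> Suc j" "j \<le> n"
    "\<And>m. i \<le> m \<Longrightarrow> m + p \<le> j \<Longrightarrow> v m = v (m + p)"
    "\<And>q. 0 < q \<Longrightarrow> q < p \<Longrightarrow> \<exists>m. i \<le> m \<and> m + q \<le> j \<and> v m \<noteq> v (m + q)"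
    "v (i - 1) \<noteq> v (i + p - 1)" "v (Suc j) \<noteq> v (Suc j - p)"
  using assms unfolding is_run_def by blast+

lemma orientation_end:
  assumes "is_run i j p"
  shows "orientation j p (v (Suc j)) (v (Suc j - p))"
  using is_runD(8)[OF assms] by (auto simp: orientation_def)

text \<open>The two suffixes agree until the later one leaves the run, and there the comparison of
  \<open>Suc j\<close> with \<open>Suc j - p\<close> is the one that fixed the orientation. So a
  Lyndon start has its next smaller suffix at distance exactly \<open>p\<close>.\<close>

lemma suffix_less_period:
  assumes run: "is_run i j p" and a: "i \<le> a" "a + p \<le> Suc j"
  shows "suffix_less (orientation j p) (a + p) a"
  unfolding lex_less_def shift_def
proof (intro exI[of _ "Suc j - p - a"] conjI allI impI)
  show "v (a + p + x) = v (a + x)" if "x < Suc j - p - a" for x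
    using is_runD(5)[OF run, of "a + x"] that a by (simp add: ac_simps)
  show "orientation j p (v (a + p + (Suc j - p - a))) (v (a + (Suc j - p - a)))"
    using orientation_end[OF run] a by simp
qed

text \<open>A least rotation of the infinite repetition \<open>u\<close> of the first
  \<open>p\<close> symbols fits into the run, since the run has length at least
  \<open>2 * p\<close>.\<close>

lemma lyndon_starts_nonempty:
  assumes run: "is_run i j p"
  shows "lyndon_starts i j p \<noteq> {}"
proof -
  note r = is_runD[OF run]
  define u where "u = (\<lambda>x. v (i + x mod p))"
  have u_v: "u (m - i) = v m" if "i \<le> m" "m \<le> j" for m
    using that
  proof (induction m rule: less_induct)
    case (less m)
    show ?case
    proof (cases "m < i + p")
      case True
      then show ?thesis
        using less by (simp add: u_def)
    next
      case False
      then have "u (m - i) = u (m - p - i)"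
        using less(2) False by (simp add: u_def le_mod_geq add.commute)
      also have "\<dots> = v (m - p)"
        using less.prems False r(2) by (intro less.IH) auto
      also have "\<dots> = v m"
        using r(5)[of "m - p"] less False by auto
      finally show ?thesis .
    qed
  qed
  have prim: "shift a u \<noteq> shift (a + q) u" if q: "0 < q" "q < p" for a q
  proof
    assume eq: "shift a u = shift (a + q) u"
    have "u x = u (x + q)" for x
    proof -
      \<comment> \<open>Going on to the multiple \<open>a * p\<close> of the period, which is at
        least \<open>a\<close>, cancels the offset \<open>a\<close>.\<close>
      have "u (a + (x + a * p - a)) = u (a + q + (x + a * p - a))"
        using fun_cong[OF eq] by (simp add: shift_def)
      moreover have "a \<le> a * p"
        using r(2) by simp
      ultimately have "u (x + a * p) = u (x + q + a * p)"
        by (simp add: ac_simps)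
      then show ?thesis
        by (simp add: u_def)
    qed
    moreover obtain m where "i \<le> m" "m + q \<le> j" "v m \<noteq> v (m + q)"
      using r(6) q by blast
    ultimately show False
      using u_v[of m] u_v[of "m + q"] by (metis add_leD1 Nat.add_diff_assoc2 trans_le_add1)
  qed
  \<comment> \<open>The window starts at offset 1 to avoid \<open>i\<close> itself, and an offset of
    at most \<open>p\<close> leaves room for a whole root before \<open>Suc j\<close>.\<close>
  have "\<exists>a. 1 \<le> a \<and> a < 1 + p \<and> (\<forall>b. a < b \<and> b < a + p \<longrightarrow>
    (\<exists>h. b + h < a + p \<and> (\<forall>x<h. u (a + x) = u (b + x)) \<and>
      orientation j p (u (a + h)) (u (b + h))))"
    by (rule ex_minimal_rotation) (use r(2) prim in \<open>auto simp: orientation_order u_def\<close>)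
  then obtain a where a: "1 \<le> a" "a < 1 + p" "\<And>b. a < b \<Longrightarrow> b < a + p \<Longrightarrow>
      \<exists>h. b + h < a + p \<and> (\<forall>x<h. u (a + x) = u (b + x)) \<and>
        orientation j p (u (a + h)) (u (b + h))"
    by blast
  have "suffix_less (orientation j p) (i + a) b" if b: "i + a < b" "b < i + a + p" for b
  proof -
    obtain h where h: "b - i + h < a + p" "\<forall>x<h. u (a + x) = u (b - i + x)"
        "orientation j p (u (a + h)) (u (b - i + h))"
    proof -
      have "a < b - i" "b - i < a + p"
        using b by linarith+
      then show ?thesis
        using a(3) that by blast
    qed
    \<comment> \<open>The deciding position lies before \<open>i + a + p\<close>, hence inside the
      run, where \<open>u\<close> and \<open>v\<close> agree; a comparison of roots thus becomes one
      of suffixes.\<close>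
    have "u (a + x) = v (i + a + x)" "u (b - i + x) = v (b + x)" if "x \<le> h" for x
      using u_v[of "i + a + x"] u_v[of "b + x"] that b h(1) a(2) r(3) by (auto simp: ac_simps)
    then show ?thesis
      unfolding lex_less_def shift_def using h by (intro exI[of _ h]) auto
  qed
  then have "i + a \<in> lyndon_starts i j p"
    using a r(3) by (auto simp: lyndon_starts_def)
  then show ?thesis
    by blast
qed

section \<open>Disjointness of the sets of Lyndon starts\<close>

lemma run_eqI:
  assumes run: "is_run i j p" "is_run i' j' p"
    and a: "i \<le> a" "i' \<le> a" "a + p \<le> Suc j" "a + p \<le> Suc j'"
  shows "i = i' \<and> j = j'"
proof -
  \<comment> \<open>Both runs contain the factor of length \<open>p\<close> at \<open>a\<close>. The
    run that starts earlier would continue the period of the other one past its left end; the right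
    ends are treated symmetrically.\<close>
  have "\<not> x < y" if "is_run x s p" "is_run y t p" "y \<le> a" "a + p \<le> Suc s" for x y s t
  proof
    assume "x < y"
    then have "v (y - 1) = v (y - 1 + p)"
      using is_runD(5)[OF that(1), of "y - 1"] that(3,4) by linarith
    then show False
      using is_runD(7)[OF that(2)] \<open>x < y\<close> by simp
  qed
  moreover have "\<not> s < t" if "is_run x s p" "is_run y t p" "y \<le> a" "a + p \<le> Suc s" for x y s t
  proof
    assume "s < t"
    then have "v (Suc s - p) = v (Suc s - p + p)"
      using is_runD(5)[OF that(2), of "Suc s - p"] that(3,4) by linarith
    then show False
      using is_runD(8)[OF that(1)] that(4) by simp
  qed
  ultimately show ?thesis
    using assms by (meson linorder_neqE_nat)
qed

text \<open>Since \<open>i\<close> and \<open>i'\<close> are excluded as starts,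
  \<open>a - 1\<close> lies in both runs, and its symbol equals \<open>v a\<close> by period 1 and
  \<open>v (a + p - 1)\<close> by period \<open>p\<close>. A root with \<open>p > 1\<close> would
  then have a border of length one, which contradicts its being Lyndon.\<close>

lemma lyndon_starts_period_one:
  assumes run: "is_run i j p" "is_run i' j' 1"
    and a: "a \<in> lyndon_starts i j p" "a \<in> lyndon_starts i' j' 1"
  shows "p = 1"
proof (rule ccontr)
  assume "p \<noteq> 1"
  note r = is_runD[OF run(1)] and r' = is_runD[OF run(2)]
  have p: "1 < p"
    using r(2) \<open>p \<noteq> 1\<close> by simp
  have a_bounds: "i < a" "a + p \<le> Suc j" "i' < a" "a \<le> j'"
    using a by (auto simp: lyndon_starts_def)
  have "v (a - 1) = v a"
    using r'(5)[of "a - 1"] a_bounds by auto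
  moreover have "v (a - 1) = v (a + p - 1)"
    using r(5)[of "a - 1"] a_bounds by auto
  moreover have less: "suffix_less (orientation j p) a b" if "a < b" "b < a + p" for b
    using a(1) that by (auto simp: lyndon_starts_def)
  have "suffix_less (orientation j p) a (a + p - 1)"
    using less p by simp
  ultimately have "suffix_less (orientation j p) (a + 1) (a + p)"
    using lex_less_shift_prefix[of "orientation j p" "shift a v" "shift (a + p - 1) v" 1]
      orientation_order p by (auto simp: shift_def)
  moreover have "suffix_less (orientation j p) (a + p) a"
    using suffix_less_period[OF run(1)] a_bounds by simp
  ultimately have "suffix_less (orientation j p) (a + 1) a"
    using lex_less_trans orientation_order by blast
  then show False
    using less[of "a + 1"] p lex_less_asym[OF orientation_order(1,2)] by simp
qed

text \<open>For equal orientations, the period is determined as the distance from \<open>a\<close>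
  to the next smaller suffix. For opposite ones, two periods above 1 would put the suffix at
  \<open>a\<close> both below and above the suffix at \<open>Suc a\<close>.\<close>

lemma lyndon_starts_disjoint:
  assumes run: "is_run i j p" "is_run i' j' p'"
    and a: "a \<in> lyndon_starts i j p" "a \<in> lyndon_starts i' j' p'"
  shows "i = i' \<and> j = j' \<and> p = p'"
proof -
  have bounds: "i < a" "a + p \<le> Suc j" "i' < a" "a + p' \<le> Suc j'"
    using a by (auto simp: lyndon_starts_def)
  have "p = p'"
  proof (cases "orientation j p = orientation j' p'")
    case True
    have "\<not> x < y" if "is_run k s x" "is_run l t y" "a \<in> lyndon_starts k s x"
      "a \<in> lyndon_starts l t y" "orientation s x = orientation t y" for x y k l s t
    proof
      assume "x < y"
      then have "suffix_less (orientation t y) a (a + x)"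
        using that(4) is_runD(2)[OF that(1)] by (auto simp: lyndon_starts_def)
      moreover have "suffix_less (orientation s x) (a + x) a"
        using suffix_less_period[OF that(1)] that(3) by (auto simp: lyndon_starts_def)
      ultimately show False
        using that(5) lex_less_asym orientation_order by metis
    qed
    then show ?thesis
      using run a True by (metis linorder_neqE_nat)
  next
    case False
    have "p = 1 \<or> p' = 1"
    proof (rule ccontr)
      assume "\<not> (p = 1 \<or> p' = 1)"
      then have "1 < p" "1 < p'"
        using is_runD(2) run by (metis le_neq_implies_less)+
      then have "suffix_less (orientation j p) a (Suc a)" "suffix_less (orientation j' p') a (Suc a)"
        using a by (auto simp: lyndon_starts_def)
      then have "suffix_less (<) a (Suc a)" "suffix_less (>) a (Suc a)"
        using False unfolding orientation_def by (auto split: if_splits)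
      then have "suffix_less (<) a (Suc a)" "suffix_less (<) (Suc a) a"
        using lex_less_converse by blast+
      then show False
        using lex_less_asym[of "(<)" "shift a v" "shift (Suc a) v"] by auto
    qed
    then show ?thesis
      using lyndon_starts_period_one run a by metis
  qed
  then show ?thesis
    using run_eqI run bounds by (metis less_imp_le)
qed

section \<open>Starts of last blocks\<close>

text \<open>As \<open>v e\<close> is the last position of the symbol at \<open>e\<close>, constancy
  up to \<open>v e\<close> says that the block starting at \<open>e\<close> is the last one of its
  symbol.\<close>

definition last_block_starts :: "nat set" where
  "last_block_starts = {e. 1 \<le> e \<and> e \<le> n \<and> v (e - 1) \<noteq> v e \<and> (\<forall>m. e \<le> m \<and> m \<le> v e \<longrightarrow> v m = v e)}"

lemma last_block_startsD:
  assumes "e \<in> last_block_starts"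
  shows "1 \<le> e" "e \<le> n" "v (e - 1) \<noteq> v e" "\<And>m. e \<le> m \<Longrightarrow> m \<le> v e \<Longrightarrow> v m = v e"
  using assms unfolding last_block_starts_def by blast+

text \<open>This is the gain from coding by last positions: whatever stands after the last
  occurrence of a symbol is larger than it.\<close>

lemma v_greater:
  assumes "1 \<le> m" "m \<le> n" "v m < k"
  shows "v m < v k"
  using assms v_bounds[of k] v_beyond[of k] v_bounds[of m] by (cases "k \<le> n") auto

text \<open>A root at \<open>e\<close> would reach beyond the last block. The period cannot continue
  to \<open>e + p\<close>, where the symbol of \<open>e\<close> no longer occurs, so the run ends
  there with a larger symbol and is oriented by \<open>(>)\<close>. But a larger symbol also follows
  the block inside the root, so the suffix at \<open>e\<close> is not the greatest.\<close>

lemma last_block_starts_not_lyndon: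
  assumes run: "is_run i j p" and e: "e \<in> last_block_starts"
  shows "e \<notin> lyndon_starts i j p"
proof
  assume a: "e \<in> lyndon_starts i j p"
  note r = is_runD[OF run]
  have bounds: "i < e" "e + p \<le> Suc j"
    using a by (auto simp: lyndon_starts_def)
  note E = last_block_startsD[OF e]
  have L: "e \<le> v e" "v e \<le> n"
    using v_bounds E(1,2) by blast+
  have "v (e - 1) = v (e + p - 1)"
    using r(5)[of "e - 1"] bounds by auto
  \<comment> \<open>Position \<open>e + p - 1\<close> carries the symbol before \<open>e\<close>, so
    it is not in the block of \<open>e\<close>.\<close>
  then have far: "v e < e + p - 1"
    using E(3) E(4)[of "e + p - 1"] r(2) by linarith
  have "orientation j p = (>)"
  proof -
    have "v (e + p) = v e" if "e + p \<le> j"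
      using r(5)[of e] that bounds by auto
    moreover have "v e < v (e + p)"
      using v_greater[OF E(1,2)] far by simp
    ultimately have "Suc j - p = e"
      using bounds(2) by fastforce
    then show ?thesis
      using \<open>v e < v (e + p)\<close> bounds by (auto simp: orientation_def)
  qed
  moreover have "suffix_less (orientation j p) e (Suc (v e))"
    using a far L by (auto simp: lyndon_starts_def)
  then have "orientation j p (v e) (v (Suc (v e))) \<or> v e = v (Suc (v e))"
    unfolding lex_less_def shift_def by (metis add.right_neutral gr0I)
  moreover have "v e < v (Suc (v e))"
    using v_greater[OF E(1,2)] by simp
  ultimately show False
    by auto
qed

lemma last_block_starts_subset: "last_block_starts \<subseteq> {1..n}"
  by (auto simp: last_block_starts_def)

lemma bij_betw_last_block_starts: "bij_betw v last_block_starts (v ` {1..n})"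
proof (rule bij_betw_imageI)
  have "\<not> e < e'" if "e \<in> last_block_starts" "e' \<in> last_block_starts" "v e = v e'" for e e'
  proof
    assume "e < e'"
    moreover have "e' \<le> v e'"
      using last_block_startsD(1,2)[OF that(2)] v_bounds by blast
    ultimately have "e \<le> e' - 1" "e' - 1 \<le> v e"
      using that(3) by auto
    then have "v (e' - 1) = v e"
      using last_block_startsD(4)[OF that(1)] by blast
    then show False
      using last_block_startsD(3)[OF that(2)] that(3) by simp
  qed
  then show "inj_on v last_block_starts"
    unfolding inj_on_def by (metis linorder_neqE_nat)
next
  have "v x \<in> v ` last_block_starts" if x: "1 \<le> x" "x \<le> n" for x
  proof -
    \<comment> \<open>The block that ends at the last occurrence \<open>v x\<close> is extended to
      the left as far as possible; the padding \<open>v 0 = 0\<close> stops it at position 1 at the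
      latest.\<close>
    define P where "P e \<longleftrightarrow> 1 \<le> e \<and> e \<le> v x \<and> (\<forall>m. e \<le> m \<and> m \<le> v x \<longrightarrow> v m = v x)" for e
    define e where "e = (LEAST e. P e)"
    have bx: "1 \<le> v x" "v x \<le> n" "v (v x) = v x"
      using v_bounds[OF x] v_last[OF x] x by auto
    then have "P (v x)"
      unfolding P_def by (auto dest: le_antisym)
    then have e: "P e"
      unfolding e_def by (rule LeastI)
    then have ve: "v e = v x"
      unfolding P_def by blast
    have "v (e - 1) \<noteq> v x"
    proof
      assume eq: "v (e - 1) = v x"
      then have "e - 1 \<noteq> 0"
        using bx v_zero by (metis not_one_le_zero)
      moreover have "v m = v x" if "e - 1 \<le> m" "m \<le> v x" for m
      proof (cases "m = e - 1")
        case False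
        then have "e \<le> m"
          using that by simp
        then show ?thesis
          using e that unfolding P_def by blast
      qed (use eq in simp)
      moreover have "1 \<le> e - 1" "e - 1 \<le> v x"
        using \<open>e - 1 \<noteq> 0\<close> e unfolding P_def by auto
      ultimately have "P (e - 1)"
        unfolding P_def by blast
      then have "e \<le> e - 1"
        unfolding e_def by (rule Least_le)
      then show False
        using \<open>e - 1 \<noteq> 0\<close> by simp
    qed
    then have "e \<in> last_block_starts"
      using e ve bx unfolding last_block_starts_def P_def mem_Collect_eq by (metis le_trans)
    then show ?thesis
      using ve by (metis imageI)
  qed
  then show "v ` last_block_starts = v ` {1..n}"
    using last_block_starts_subset by auto
qed

section \<open>Counting runs by one chosen start each\<close>

definition all_runs :: "(nat \<times> nat \<times> nat) set" where
  "all_runs = {(i, j, p). is_run i j p}"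

definition root_start :: "nat \<times> nat \<times> nat \<Rightarrow> nat" where
  "root_start = (\<lambda>(i, j, p). SOME a. a \<in> lyndon_starts i j p)"

lemma root_start:
  assumes "is_run i j p"
  shows "root_start (i, j, p) \<in> lyndon_starts i j p"
  using lyndon_starts_nonempty[OF assms] by (auto simp: root_start_def some_in_eq)

lemma root_start_eq:
  assumes "t \<in> all_runs" "is_run i j p" "root_start t \<in> lyndon_starts i j p"
  shows "t = (i, j, p)"
  using assms root_start lyndon_starts_disjoint unfolding all_runs_def by fast

lemma inj_on_root_start: "inj_on root_start all_runs"
  using root_start_eq root_start by (fastforce intro: inj_onI simp: all_runs_def)

lemma root_start_image: "root_start ` all_runs \<subseteq> {1..n} - last_block_starts"
proof
  fix x
  assume "x \<in> root_start ` all_runs"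
  then obtain i j p where run: "is_run i j p" and x: "x \<in> lyndon_starts i j p"
    using root_start by (auto simp: all_runs_def)
  have "i < x" "x + p \<le> Suc j"
    using x by (auto simp: lyndon_starts_def)
  then have "1 \<le> x" "x \<le> n"
    using is_runD[OF run] by auto
  then show "x \<in> {1..n} - last_block_starts"
    using last_block_starts_not_lyndon[OF run] x by auto
qed

text \<open>A block of length at least two is a run of period 1. The second conjunct gives its right
  end as a bound for every constant stretch from \<open>i\<close>.\<close>

lemma block_run:
  assumes "1 \<le> i" "Suc i \<le> n" "v (i - 1) \<noteq> v i" "v (Suc i) = v i"
  shows "\<exists>j. is_run i j 1 \<and> (\<forall>k. (\<forall>m. i \<le> m \<and> m \<le> k \<longrightarrow> v m = v i) \<longrightarrow> k \<le> j)"
proof -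
  define j where "j = (LEAST j. i \<le> j \<and> v (Suc j) \<noteq> v i)"
  have "i \<le> n \<and> v (Suc n) \<noteq> v i"
    using assms v_bounds[of i] v_beyond[of "Suc n"] by auto
  then have j: "i \<le> j \<and> v (Suc j) \<noteq> v i" and "j \<le> n"
    unfolding j_def by (rule LeastI, rule Least_le)
  have const: "v m = v i" if "i \<le> m" "m \<le> j" for m
  proof (cases "m = i")
    case False
    then have "m - 1 < j" "i \<le> m - 1" "Suc (m - 1) = m"
      using that by auto
    then show ?thesis
      using not_less_Least[of "m - 1" "\<lambda>j. i \<le> j \<and> v (Suc j) \<noteq> v i"] unfolding j_def by auto
  qed simp
  have "i \<noteq> j"
    using j assms(4) by blast
  have "is_run i j 1"
    unfolding is_run_def
  proof (intro conjI allI impI)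
    show "v m = v (m + 1)" if "i \<le> m \<and> m + 1 \<le> j" for m
      using const[of m] const[of "m + 1"] that by simp
  qed (use assms(1,3) j \<open>j \<le> n\<close> const[of j] \<open>i \<noteq> j\<close> in auto)
  moreover have "k \<le> j" if "\<forall>m. i \<le> m \<and> m \<le> k \<longrightarrow> v m = v i" for k
    using that j by (metis le_SucI not_less_eq_eq)
  ultimately show ?thesis
    by blast
qed

text \<open>\<open>F\<close> consists of the second positions of last blocks, so \<open>?E\<close>
  and \<open>F\<close> together miss some position. All positions before the least missed one,
  \<open>k\<close>, lie in last blocks.\<close>

lemma ex_free_position:
  assumes "2 * card last_block_starts < n"
  shows "\<exists>x\<in>{1..n} - last_block_starts. x \<notin> root_start ` all_runs"
proof -
  let ?E = "last_block_starts"
  define F where "F = {Suc e | e. e \<in> ?E \<and> v (Suc e) = v e}"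
  have fin: "finite ?E"
    using last_block_starts_subset finite_subset by blast
  have F_sub: "F \<subseteq> Suc ` ?E"
    by (auto simp: F_def)
  then have "card F \<le> card ?E"
    using fin by (meson card_image_le card_mono finite_imageI le_trans)
  then have "card (?E \<union> F) < n"
    using card_Un_le[of ?E F] assms by linarith
  moreover have "finite (?E \<union> F)"
    using fin F_sub finite_subset by blast
  ultimately have "\<not> {1..n} \<subseteq> ?E \<union> F"
    using card_mono[of "?E \<union> F" "{1..n}"] by auto
  then have ex: "\<exists>k. 1 \<le> k \<and> k \<le> n \<and> k \<notin> ?E \<union> F"
    by auto
  define k where "k = (LEAST k. 1 \<le> k \<and> k \<le> n \<and> k \<notin> ?E \<union> F)"
  have k: "1 \<le> k" "k \<le> n" "k \<notin> ?E" "k \<notin> F"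
    using LeastI_ex[OF ex] unfolding k_def by auto
  have before: "m \<in> ?E \<union> F" if "1 \<le> m" "m < k" for m
    using not_less_Least[of m "\<lambda>k. 1 \<le> k \<and> k \<le> n \<and> k \<notin> ?E \<union> F"] that k(2)
    unfolding k_def by auto
  show ?thesis
  proof (cases "v (k - 1) = v k")
    case False
    \<comment> \<open>A run with start \<open>k\<close> also contains \<open>k - 1\<close>, and its
      period repeats the symbol of \<open>k - 1\<close> at or after \<open>k\<close>. The last block
      containing \<open>k - 1\<close> would then extend over \<open>k\<close>, but a new block
      begins there.\<close>
    have "k \<notin> root_start ` all_runs"
    proof
      assume "k \<in> root_start ` all_runs"
      then obtain i j p where run: "is_run i j p" and start: "k \<in> lyndon_starts i j p"
        using root_start by (auto simp: all_runs_def)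
      note r = is_runD[OF run]
      have bounds: "i < k" "k + p \<le> Suc j"
        using start by (auto simp: lyndon_starts_def)
      then have "k - 1 \<in> ?E \<union> F"
        using before[of "k - 1"] r(1) by auto
      then have block: "v m = v (k - 1)" if "k - 1 \<le> m" "m \<le> v (k - 1)" for m
      proof
        assume "k - 1 \<in> F"
        then obtain e where "e \<in> ?E" "k - 1 = Suc e" "v (k - 1) = v e"
          unfolding F_def by auto
        then show ?thesis
          using last_block_startsD(4)[of e m] that by simp
      qed (use last_block_startsD(4) that in blast)
      have eq: "v (k - 1) = v (k + p - 1)"
        using r(5)[of "k - 1"] bounds by auto
      have "k + p - 1 \<le> v (k + p - 1)"
        using v_bounds[of "k + p - 1"] bounds r by auto
      then have "k \<le> v (k - 1)"
        using eq r(2) by linarith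
      then show False
        using block[of k] False by simp
    qed
    then show ?thesis
      using k by auto
  next
    case True
    have "k \<noteq> 1"
      using True k v_zero v_bounds[of k] by auto
    then have "k - 1 \<in> ?E \<union> F"
      using before[of "k - 1"] k by auto
    \<comment> \<open>If \<open>k - 1\<close> started a last block, \<open>k\<close> would be its
      second position and belong to \<open>F\<close>. Hence \<open>k\<close> is the third position
      of a last block.\<close>
    moreover have "k - 1 \<notin> ?E"
      using True k(1,4) unfolding F_def by force
    ultimately obtain e where e: "e \<in> ?E" "v (Suc e) = v e" "k - 1 = Suc e"
      by (auto simp: F_def)
    have k_eq: "k = Suc (Suc e)"
      using e(3) by simp
    have "1 \<le> e" "v (e - 1) \<noteq> v e" "Suc e \<le> n"
      using last_block_startsD(1,3)[OF e(1)] k(2) k_eq by simp_all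
    then obtain j where j: "is_run e j 1" "\<And>k. (\<forall>m. e \<le> m \<and> m \<le> k \<longrightarrow> v m = v e) \<Longrightarrow> k \<le> j"
      using block_run e(2) by blast
    have "k \<le> j"
    proof (rule j(2), intro allI impI)
      fix m
      assume "e \<le> m \<and> m \<le> k"
      then have "m = e \<or> m = Suc e \<or> m = Suc (Suc e)"
        using k_eq by auto
      then show "v m = v e"
        using True e(2) k_eq by (elim disjE) simp_all
    qed
    \<comment> \<open>Both \<open>k - 1\<close> and \<open>k\<close> are Lyndon starts of the same
      run of period 1, but only one of them can be its chosen start.\<close>
    have "x = root_start (e, j, 1)" if "x \<in> root_start ` all_runs" "x \<in> {k - 1, k}" for x
    proof -
      have "x \<in> lyndon_starts e j 1"
        using that(2) \<open>k \<le> j\<close> k_eq by (auto simp: lyndon_starts_def)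
      then show ?thesis
        using root_start_eq[OF _ j(1)] that(1) by (metis imageE)
    qed
    then have "\<not> (k - 1 \<in> root_start ` all_runs \<and> k \<in> root_start ` all_runs)"
      using k_eq by (metis diff_Suc_1 insertI1 insertI2 n_not_Suc_n)
    moreover have "k - 1 \<in> {1..n} - ?E" "k \<in> {1..n} - ?E"
      using k(1-3) \<open>k - 1 \<notin> ?E\<close> \<open>k \<noteq> 1\<close> by auto
    ultimately show ?thesis
      by blast
  qed
qed

lemma card_all_runs:
  "card all_runs \<le> n - card (v ` {1..n})"
  "2 * card (v ` {1..n}) < n \<Longrightarrow> card all_runs \<le> n - card (v ` {1..n}) - 1"
proof -
  let ?S = "{1..n} - last_block_starts"
  have E: "card last_block_starts = card (v ` {1..n})"
    using bij_betw_last_block_starts by (rule bij_betw_same_card)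
  have S: "card ?S = n - card (v ` {1..n})"
    using last_block_starts_subset E by (simp add: card_Diff_subset finite_subset)
  have runs: "card all_runs = card (root_start ` all_runs)"
    using inj_on_root_start by (simp add: card_image)
  show "card all_runs \<le> n - card (v ` {1..n})"
    using card_mono[OF _ root_start_image] runs S by simp
  assume "2 * card (v ` {1..n}) < n"
  then obtain x where x: "x \<in> ?S" "x \<notin> root_start ` all_runs"
    using ex_free_position E by auto
  then have "card (root_start ` all_runs) \<le> card (?S - {x})"
    using root_start_image by (intro card_mono) auto
  then show "card all_runs \<le> n - card (v ` {1..n}) - 1"
    using runs S x(1) by simp
qed

end

section \<open>Runs of lists\<close>

text \<open>The two values outside the string are the end markers of the locale. Coding by positions
  supplies an order even if the alphabet has none.\<close>

definition last_pos :: "'a list \<Rightarrow> nat \<Rightarrow> nat" where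
  "last_pos w m = (if m = 0 then 0 else if length w < m then Suc (length w)
    else Max {k \<in> {1..length w}. sym w k = sym w m})"

lemma last_pos_props:
  assumes "1 \<le> m" "m \<le> length w"
  shows "m \<le> last_pos w m" "last_pos w m \<le> length w" "sym w (last_pos w m) = sym w m"
proof -
  let ?A = "{k \<in> {1..length w}. sym w k = sym w m}"
  have "last_pos w m = Max ?A"
    using assms by (simp add: last_pos_def)
  moreover have "m \<in> ?A"
    using assms by simp
  moreover have "Max ?A \<in> ?A"
    using \<open>m \<in> ?A\<close> by (intro Max_in) auto
  ultimately show "m \<le> last_pos w m" "last_pos w m \<le> length w" "sym w (last_pos w m) = sym w m"
    by (auto intro: Max_ge)
qed

lemma last_pos_eq_iff:
  assumes "1 \<le> m" "m \<le> length w" "1 \<le> k" "k \<le> length w"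
  shows "last_pos w m = last_pos w k \<longleftrightarrow> sym w m = sym w k"
proof
  show "sym w m = sym w k" if "last_pos w m = last_pos w k"
    using last_pos_props(3) assms that by metis
qed (use assms in \<open>simp add: last_pos_def\<close>)

context
  fixes w :: "'a list"
begin

interpretation last_pos: last_position_coding "length w" "last_pos w"
proof
  show "last_pos w (last_pos w m) = last_pos w m" if "1 \<le> m" "m \<le> length w" for m
    using last_pos_props[OF that] that by (subst last_pos_eq_iff) auto
next
  show "m \<le> last_pos w m \<and> last_pos w m \<le> length w" if "1 \<le> m" "m \<le> length w" for m
    using last_pos_props that by blast
qed (simp_all add: last_pos_def)

lemma sym_substring:
  assumes "1 \<le> i" "j \<le> length w" "1 \<le> m" "m \<le> j + 1 - i"
  shows "sym (substring w i j) m = sym w (i - 1 + m)"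
  using assms by (auto simp: sym_def substring_def)

lemma is_period_substring:
  assumes "1 \<le> i" "i \<le> j" "j \<le> length w"
  shows "is_period (substring w i j) p \<longleftrightarrow>
    1 \<le> p \<and> (\<forall>m. i \<le> m \<and> m + p \<le> j \<longrightarrow> last_pos w m = last_pos w (m + p))"
proof -
  have len: "length (substring w i j) = j + 1 - i"
    using assms by (simp add: substring_def)
  have "(\<forall>m. 1 \<le> m \<and> m \<le> j + 1 - i - p \<longrightarrow>
      sym (substring w i j) m = sym (substring w i j) (m + p)) \<longleftrightarrow>
    (\<forall>m. i \<le> m \<and> m + p \<le> j \<longrightarrow> last_pos w m = last_pos w (m + p))" (is "?L \<longleftrightarrow> ?R")
  proof
    assume L: ?L
    show ?R
    proof (intro allI impI)
      fix m
      assume "i \<le> m \<and> m + p \<le> j"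
      then have "sym w m = sym w (m + p)"
        using L[rule_format, of "m + 1 - i"] assms
        by (simp add: sym_substring add.commute le_diff_conv2)
      then show "last_pos w m = last_pos w (m + p)"
        using \<open>i \<le> m \<and> m + p \<le> j\<close> assms by (subst last_pos_eq_iff) auto
    qed
  next
    assume R: ?R
    show ?L
    proof (intro allI impI)
      fix m
      assume m: "1 \<le> m \<and> m \<le> j + 1 - i - p"
      then have "last_pos w (i - 1 + m) = last_pos w (i - 1 + m + p)"
        using R[rule_format, of "i - 1 + m"] assms by linarith
      then show "sym (substring w i j) m = sym (substring w i j) (m + p)"
        using m assms by (subst (asm) last_pos_eq_iff) (auto simp: sym_substring add.assoc)
    qed
  qed
  then show ?thesis
    by (simp add: is_period_def len)
qed

text \<open>Inside the string, codes coincide exactly when symbols do; at \<open>i = 1\<close> and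
  \<open>j = length w\<close> the end markers provide the inequalities.\<close>

lemma runs_subset_all_runs: "runs w \<subseteq> last_pos.all_runs"
proof (clarsimp simp: last_pos.all_runs_def)
  fix i j p
  assume "(i, j, p) \<in> runs w"
  then have r: "1 \<le> i" "i \<le> j" "j \<le> length w" "is_period (substring w i j) p"
    "\<And>q. is_period (substring w i j) q \<Longrightarrow> p \<le> q" "2 * p \<le> j - i + 1"
    "i = 1 \<or> sym w (i - 1) \<noteq> sym w (i + p - 1)"
    "j = length w \<or> sym w (j + 1) \<noteq> sym w (j - p + 1)"
    by (auto simp: runs_def is_smallest_period_def)
  note per = is_period_substring[OF r(1-3)]
  have p: "1 \<le> p" "\<forall>m. i \<le> m \<and> m + p \<le> j \<longrightarrow> last_pos w m = last_pos w (m + p)"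
    using r(4) per by blast+
  have "\<exists>m. i \<le> m \<and> m + q \<le> j \<and> last_pos w m \<noteq> last_pos w (m + q)" if "0 < q \<and> q < p" for q
    using r(5)[of q] per[of q] that by auto
  moreover have "last_pos w (i - 1) \<noteq> last_pos w (i + p - 1)"
  proof (cases "i = 1")
    case True
    then show ?thesis
      using last_pos_props(1)[of "i + p - 1" w] p(1) r by (auto simp: last_pos.v_zero)
  next
    case False
    then show ?thesis
      using r p(1) by (subst last_pos_eq_iff) auto
  qed
  moreover have "last_pos w (Suc j) \<noteq> last_pos w (Suc j - p)"
  proof (cases "j = length w")
    case True
    then show ?thesis
      using last_pos_props(2)[of "Suc j - p" w] p(1) r(1,2,6) last_pos.v_beyond[of "Suc j"]
      by linarith
  next
    case False
    then show ?thesis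
      using r p(1) by (subst last_pos_eq_iff) (auto simp: Suc_diff_le)
  qed
  ultimately show "last_pos.is_run i j p"
    unfolding last_pos.is_run_def using r p by auto
qed

lemma card_last_pos: "card (last_pos w ` {1..length w}) = card (set w)"
proof -
  have "{1..length w} = Suc ` {..<length w}"
    by (simp add: lessThan_atLeast0 image_Suc_atLeastLessThan atLeastLessThanSuc_atLeastAtMost)
  then have "set w = sym w ` {1..length w}"
    by (auto simp: sym_def set_conv_nth image_image)
  \<comment> \<open>A code is itself a position of the symbol it stands for, so \<open>sym w\<close>
    decodes it.\<close>
  moreover have "sym w ` last_pos w ` {1..length w} = sym w ` {1..length w}"
    unfolding image_image using last_pos_props(3)[of _ w] by (intro image_cong) auto
  ultimately have "sym w ` last_pos w ` {1..length w} = set w"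
    by simp
  moreover have "inj_on (sym w) (last_pos w ` {1..length w})"
    using last_pos_props(3)[of _ w] last_pos_eq_iff[of _ w] by (auto intro!: inj_onI)
  ultimately show ?thesis
    using card_image by metis
qed

lemma card_runs:
  "card (runs w) \<le> length w - card (set w)"
  "2 * card (set w) < length w \<Longrightarrow> card (runs w) \<le> length w - card (set w) - 1"
proof -
  have "finite last_pos.all_runs"
    using last_pos.inj_on_root_start last_pos.root_start_image
    by (rule inj_on_finite) simp
  then have "card (runs w) \<le> card last_pos.all_runs"
    using runs_subset_all_runs by (rule card_mono)
  then show "card (runs w) \<le> length w - card (set w)"
    "2 * card (set w) < length w \<Longrightarrow> card (runs w) \<le> length w - card (set w) - 1"
    using last_pos.card_all_runs unfolding card_last_pos by linarith+
qed

end

theorem theorem4: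
  fixes n d :: nat
  assumes "1 \<le> d" and "d \<le> n"
  shows "\<rho> n d \<le> n - d \<and> (n > 2 * d \<longrightarrow> \<rho> n d \<le> n - d - 1)"
proof -
  have "\<rho> n d \<in> run_counts n d"
    unfolding \<rho>_def using finite_run_counts run_counts_nonempty[OF assms] by (rule Max_in)
  then obtain w :: "nat list" where "\<rho> n d = card (runs w)" "length w = n" "card (set w) = d"
    unfolding run_counts_def by blast
  then show ?thesis
    using card_runs[of w] by auto
qed

end
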